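(* Let $R$ be a commutative ring (with $1\neq 0$) of stable dimension $\mathrm{sdim}(R)=d$. Let $m,n$ be integers with $m\geq 2$, $n>m$ and $d\leq 2(n-m)-1$, and let $S,T\in Um_{m,n}(R)$. Then there exist $\varepsilon_1,\varepsilon_2\in E_n(R)$, a matrix $X\in M_{m\times m}(R)$ and a matrix $\alpha\in M_{m\times(n-m)}(R)$ such that $$S\varepsilon_1=(X,\alpha),\qquad T\varepsilon_2=(I-X,\alpha),$$ where $I$ is the $m\times m$ identity matrix and $(A,\alpha)$ denotes the $m\times n$ block matrix whose first $m$ columns form $A$ and whose last $n-m$ columns form $\alpha$.
   Context: $Um_{m,n}(R)$ is the set of right invertible $m\times n$ matrices over $R$, i.e. those $\alpha\in M_{m\times n}(R)$ for which there is $\beta\in M_{n\times m}(R)$ with $\alpha\beta=I_m$. $E_n(R)\subseteq GL_n(R)$ is the subgroup generated by the elementary matrices $e_{ij}(\lambda)=I_n+\lambda E_{ij}$ with $\lambda\in R$, $1\le i\neq j\le n$, where $E_{ij}$ has $1$ in position $(i,j)$ and $0$ elsewhere. A row $(a_1,\dots,a_k)\in R^k$ is unimodular if there are $b_i\in R$ with $\sum_i a_ib_i=1$; $Um_k(R)$ is the set of unimodular rows of length $k$. The condition $\mathrm{sr}_k(R)$ holds if for every $(a_1,\dots,a_{k+1})\in Um_{k+1}(R)$ there exist $c_1,\dots,c_k\in R$ with $(a_1+c_1a_{k+1},\dots,a_k+c_ka_{k+1})\in Um_k(R)$. The stable range $\mathrm{sr}(R)$ is the least integer $k$ such that $\mathrm{sr}_k(R)$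 holds, and the stable dimension is $\mathrm{sdim}(R)=\mathrm{sr}(R)-1$. *)

theory Defs
  imports
    "HOL-Library.Extended_Nat"
    "HOL-Algebra.Generated_Groups"
    "Jordan_Normal_Form.Matrix"
    "Jordan_Normal_Form.Gauss_Jordan_Elimination"
begin

text \<open>Vectors and matrices are 0-indexed, so row and column indices run over \<open>{..<n}\<close>.\<close>

definition Um_row :: "nat \<Rightarrow> 'a :: comm_ring_1 vec set" where
  "Um_row k = {a \<in> carrier_vec k. \<exists>b \<in> carrier_vec k. a \<bullet> b = 1}"

definition Um_mat :: "nat \<Rightarrow> nat \<Rightarrow> 'a :: comm_ring_1 mat set" where
  "Um_mat m n = {A \<in> carrier_mat m n. \<exists>B \<in> carrier_mat n m. A * B = 1\<^sub>m m}"

text \<open>In \<open>sr_cond\<close>, the last entry of a row of length \<open>k + 1\<close> is \<open>a $ k\<close>.\<close>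

definition sr_cond :: "'a :: comm_ring_1 itself \<Rightarrow> nat \<Rightarrow> bool" where
  "sr_cond _ k \<longleftrightarrow>
     (\<forall>a \<in> (Um_row (k + 1) :: 'a vec set). \<exists>c \<in> carrier_vec k.
        vec k (\<lambda>i. a $ i + c $ i * a $ k) \<in> Um_row k)"

text \<open>The stable range is \<open>\<infinity>\<close> if no condition \<open>sr_cond\<close> holds (\<open>Inf {} = \<infinity>\<close> in \<^typ>\<open>enat\<close>).
  Since \<open>1 \<noteq> 0\<close>, it is at least 1, so the subtraction in \<open>sdim\<close> does not truncate.\<close>

definition stable_range :: "'a :: comm_ring_1 itself \<Rightarrow> enat" where
  "stable_range R = Inf (enat ` {k. sr_cond R k})"

lemma not_sr_cond_0: "\<not> sr_cond TYPE('a :: comm_ring_1) 0"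
proof
  assume "sr_cond TYPE('a) 0"
  moreover have "vec 1 (\<lambda>_. 1) \<in> (Um_row (0 + 1) :: 'a vec set)"
    unfolding Um_row_def
    by (auto intro!: bexI[of _ "vec 1 (\<lambda>_. 1)"] simp: scalar_prod_def)
  ultimately show False
    unfolding sr_cond_def by (auto simp: Um_row_def scalar_prod_def)
qed

lemma stable_range_ge_1: "1 \<le> stable_range TYPE('a :: comm_ring_1)"
proof -
  have "1 \<le> enat k" if "sr_cond TYPE('a) k" for k
    using that not_sr_cond_0[where 'a = 'a] by (cases k) (auto simp: one_enat_def)
  then show ?thesis
    unfolding stable_range_def by (auto intro!: Inf_greatest)
qed

definition sdim :: "'a :: comm_ring_1 itself \<Rightarrow> enat" where
  "sdim R = stable_range R - 1"

text \<open>\<open>addrow_mat n c i j\<close> is the matrix with 1 on the diagonal, \<open>c\<close> in position \<open>(i, j)\<close> and 0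
  elsewhere (for \<open>i \<noteq> j\<close>), and \<open>GL_group n\<close> consists of the invertible \<open>n \<times> n\<close> matrices.\<close>

definition GL_group :: "nat \<Rightarrow> 'a :: comm_ring_1 mat monoid" where
  "GL_group n = units_of (ring_mat TYPE('a) n ())"

definition E_group :: "nat \<Rightarrow> 'a :: comm_ring_1 mat set" where
  "E_group n = generate (GL_group n) {addrow_mat n c i j | c i j. i < n \<and> j < n \<and> i \<noteq> j}"

definition append_cols :: "'a :: zero mat \<Rightarrow> 'a mat \<Rightarrow> 'a mat" where
  "append_cols A B = four_block_mat A B (0\<^sub>m 0 (dim_col A)) (0\<^sub>m 0 (dim_col B))"

end

theory Submission
  imports Defs
begin

text \<open>
  Write \<open>r = n - m\<close>. Suppose that right multiplication by elementary matrices has brought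
  \<open>S\<close> and \<open>T\<close> to the forms \<open>(X, \<alpha>)\<close> and \<open>(Y, \<beta>)\<close> with \<open>X + Y = 1\<close>. Then adding \<open>X (\<beta> - \<alpha>)\<close> to \<open>\<alpha>\<close>
  and \<open>Y (\<alpha> - \<beta>)\<close> to \<open>\<beta>\<close> produces the same block \<open>Y \<alpha> + X \<beta>\<close> twice, and both moves are elementary.
  So the whole problem is to make the two leading square blocks sum to the identity.

  This is done one column at a time, as in the Mennicke--Newman lemma for unimodular rows.
  Assume that the first \<open>k\<close> columns of \<open>S\<close> and \<open>T\<close> already have the sums \<open>e\<^sub>0, \<dots>, e\<^sub>k\<^sub>-\<^sub>1\<close>, and look at
  row \<open>k\<close>, with entries \<open>a\<close> in \<open>S\<close> and \<open>b\<close> in \<open>T\<close>. Both rows are unimodular: \<open>\<Sum>a\<^sub>j p\<^sub>j = 1 = \<Sum>b\<^sub>j q\<^sub>j\<close>.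
  Cut both sums after index \<open>k\<close> and let \<open>P\<close>, \<open>Q\<close> be the initial parts. The product of
  the two relations shows that the later entries of both rows, together with the single element
  \<open>P Q\<close>, form a unimodular row. There are \<open>2 (n - 1 - k) \<ge> 2 r\<close> later entries, so the
  stable range condition makes them unimodular by adding multiples of \<open>P Q\<close> to them. Now \<open>P Q\<close>
  is a combination of \<open>a\<^sub>0, \<dots>, a\<^sub>k\<close> and also one of \<open>b\<^sub>0, \<dots>, b\<^sub>k\<close>, so each addition is
  an elementary column operation on \<open>S\<close> or on \<open>T\<close> alone. After these, \<open>1 - a\<^sub>k - b\<^sub>k\<close> is a combination of
  the later entries, and adding later columns to column \<open>k\<close> gives \<open>a\<^sub>k + b\<^sub>k = 1\<close>
  (\<open>diagonal_sum_one\<close>).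

  The sum of the two columns \<open>k\<close> is then a vector with entry 1 in row \<open>k\<close>. Elementary row
  operations, the same for \<open>S\<close> and \<open>T\<close>, turn it into \<open>e\<^sub>k\<close> and fix the earlier \<open>e\<^sub>j\<close>
  (\<open>leading_columns_sum\<close>). After \<open>m\<close> steps a matrix \<open>G\<close> has accumulated on the left. It is removed
  by conjugation: \<open>G\<^sup>-\<^sup>1 (X + Y) G = 1\<close>, and the right factor \<open>G\<close>, extended by an
  identity block, is elementary of size \<open>n\<close>. Because the row operations are tolerated, only one entry of the
  column sum has to be controlled in each step, and so the bound involves \<open>m\<close> only through \<open>n - m\<close>.
\<close>

section \<open>Elementary matrices\<close>

lemma index_mult_mat_sum:
  assumes "A \<in> carrier_mat m l" "B \<in> carrier_mat l n" "i < m" "j < n"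
  shows "(A * B) $$ (i, j) = (\<Sum>k<l. A $$ (i, k) * B $$ (k, j))"
  using assms by (auto simp: scalar_prod_def lessThan_atLeast0 intro!: sum.cong)

lemma index_mult_one_plus:
  fixes A N :: "'a :: comm_ring_1 mat"
  assumes "A \<in> carrier_mat m n" "N \<in> carrier_mat n n" "i < m" "j < n"
  shows "(A * (1\<^sub>m n + N)) $$ (i, j) = A $$ (i, j) + (\<Sum>k<n. A $$ (i, k) * N $$ (k, j))"
proof -
  have "A * (1\<^sub>m n + N) = A + A * N"
    using assms by (simp add: mult_add_distrib_mat[of _ m n _ n])
  then show ?thesis
    using assms index_mult_mat_sum[of A m n N n i j] by simp
qed

lemma E_group_generators_subset:
  "{addrow_mat n c i j | c i j. i < n \<and> j < n \<and> i \<noteq> j} \<subseteq> carrier (GL_group n :: 'a :: comm_ring_1 mat monoid)"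
  by (auto simp: GL_group_def units_of_def intro: addrow_mat_Unit)

lemma E_group_unit:
  fixes A :: "'a :: comm_ring_1 mat"
  assumes "A \<in> E_group n"
  shows "A \<in> carrier_mat n n" "\<exists>B \<in> carrier_mat n n. A * B = 1\<^sub>m n \<and> B * A = 1\<^sub>m n"
proof -
  interpret ring "ring_mat TYPE('a) n ()" by (rule ring_mat)
  have "group (GL_group n :: 'a mat monoid)"
    unfolding GL_group_def by (rule units_group)
  then have "A \<in> carrier (GL_group n)"
    using assms group.generate_in_carrier[OF _ E_group_generators_subset]
    unfolding E_group_def by blast
  then have "A \<in> Units (ring_mat TYPE('a) n ())"
    by (simp add: GL_group_def units_of_def)
  then show "A \<in> carrier_mat n n" "\<exists>B \<in> carrier_mat n n. A * B = 1\<^sub>m n \<and> B * A = 1\<^sub>m n"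
    by (auto simp: Units_def ring_mat_simps)
qed

lemma E_group_mult: "A \<in> E_group n \<Longrightarrow> B \<in> E_group n \<Longrightarrow> A * B \<in> E_group n"
  using generate.eng[of A "GL_group n" _ B]
  by (simp add: E_group_def GL_group_def units_of_def ring_mat_simps)

lemma E_group_one: "1\<^sub>m n \<in> E_group n"
  using generate.one[of "GL_group n"]
  by (simp add: E_group_def GL_group_def units_of_def ring_mat_simps)

lemma E_group_addrow: "i < n \<Longrightarrow> j < n \<Longrightarrow> i \<noteq> j \<Longrightarrow> addrow_mat n c i j \<in> E_group n"
  unfolding E_group_def by (rule generate.incl) auto

text \<open>All column operations below add columns with index in \<open>I\<close> to columns with index outside \<open>I\<close>.
  Such additions do not interfere with each other, so performing them one entry at a time
  builds up \<open>1 + N\<close>.\<close>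

lemma E_group_shear:
  fixes N :: "'a :: comm_ring_1 mat"
  assumes N: "N \<in> carrier_mat n n"
    and supp: "\<And>i j. i < n \<Longrightarrow> j < n \<Longrightarrow> N $$ (i, j) \<noteq> 0 \<Longrightarrow> i \<in> I \<and> j \<notin> I"
  shows "1\<^sub>m n + N \<in> E_group n"
proof -
  define M where "M F = mat n n (\<lambda>p. if p \<in> F then N $$ p else 0)" for F
  \<comment> \<open>Induction over the set \<open>F\<close> of entries of \<open>N\<close> that have been added so far.\<close>
  have "1\<^sub>m n + M F \<in> E_group n" if "finite F" "F \<subseteq> ({..<n} \<inter> I) \<times> ({..<n} - I)" for F
    using that
  proof (induction F)
    case empty
    have "1\<^sub>m n + M {} = 1\<^sub>m n" by (auto simp: M_def)
    then show ?case by (simp add: E_group_one)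
  next
    case (insert p F)
    obtain r s where p: "p = (r, s)" by (cases p)
    have rs: "r < n" "s < n" "r \<in> I" "s \<notin> I" using insert.prems p by auto
    define a where "a = N $$ (r, s)"
    define Q where "Q = mat n n (\<lambda>q. if q = (r, s) then a else 0)"
    have add: "addrow_mat n a r s = 1\<^sub>m n + Q"
      using rs by (auto simp: addrow_mat_def Q_def)
    \<comment> \<open>Column \<open>r \<in> I\<close> of \<open>M F\<close> vanishes, so multiplying by \<open>1 + a E\<^sub>r\<^sub>s\<close> only adds the entry \<open>a\<close>.\<close>
    have "1\<^sub>m n + M (insert p F) = (1\<^sub>m n + M F) * (1\<^sub>m n + Q)"
    proof (rule eq_matI)
      fix i j assume "i < dim_row ((1\<^sub>m n + M F) * (1\<^sub>m n + Q))"
        "j < dim_col ((1\<^sub>m n + M F) * (1\<^sub>m n + Q))"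
      then have ij: "i < n" "j < n" by (simp_all add: M_def Q_def)
      have "(\<Sum>k<n. (1\<^sub>m n + M F) $$ (i, k) * Q $$ (k, j))
          = (\<Sum>k<n. if k = r then (1\<^sub>m n + M F) $$ (i, r) * Q $$ (r, j) else 0)"
        by (rule sum.cong) (auto simp: Q_def ij)
      also have "\<dots> = (1\<^sub>m n + M F) $$ (i, r) * Q $$ (r, j)"
        using rs by simp
      also have "\<dots> = (if i = r \<and> j = s then a else 0)"
        using insert.prems rs ij by (auto simp: Q_def M_def)
      finally have "((1\<^sub>m n + M F) * (1\<^sub>m n + Q)) $$ (i, j)
          = (1\<^sub>m n + M F) $$ (i, j) + (if i = r \<and> j = s then a else 0)"
        using ij index_mult_one_plus[of "1\<^sub>m n + M F" n n Q i j] by (simp add: M_def Q_def)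
      then show "(1\<^sub>m n + M (insert p F)) $$ (i, j) = ((1\<^sub>m n + M F) * (1\<^sub>m n + Q)) $$ (i, j)"
        using ij insert.hyps p by (auto simp: M_def a_def)
    qed (auto simp: M_def Q_def)
    moreover have "1\<^sub>m n + M F \<in> E_group n" using insert by auto
    moreover have "1\<^sub>m n + Q \<in> E_group n"
      using E_group_addrow[of r n s a] rs add by auto
    ultimately show ?case by (simp add: E_group_mult)
  qed
  from this[of "({..<n} \<inter> I) \<times> ({..<n} - I)"]
  have "1\<^sub>m n + M (({..<n} \<inter> I) \<times> ({..<n} - I)) \<in> E_group n" by simp
  moreover have "M (({..<n} \<inter> I) \<times> ({..<n} - I)) = N"
    using N supp by (intro eq_matI) (auto simp: M_def)
  ultimately show ?thesis by simp
qed

section \<open>Stable range for finite families\<close>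

lemma sr_cond_of_sdim:
  assumes "sdim TYPE('a :: comm_ring_1) = enat d"
  shows "sr_cond TYPE('a) (d + 1)"
proof -
  have ge: "1 \<le> stable_range TYPE('a)" by (rule stable_range_ge_1)
  then have eq: "stable_range TYPE('a) = enat (d + 1)"
    using assms unfolding sdim_def
    by (cases "stable_range TYPE('a)") (auto simp: one_enat_def)
  then have "enat ` {k. sr_cond TYPE('a) k} \<noteq> {}"
    unfolding stable_range_def Inf_enat_def by (metis enat.distinct(1))
  then have "stable_range TYPE('a) \<in> enat ` {k. sr_cond TYPE('a) k}"
    unfolding stable_range_def Inf_enat_def by (auto intro: LeastI)
  then show ?thesis using eq by auto
qed

text \<open>Passing from \<open>s\<close> to a larger family costs nothing: choose \<open>s\<close> of its members as
  receivers, and let \<open>w'\<close> collect \<open>w\<close> and the other terms of the given relation. The condition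
  gives multiples of \<open>w'\<close> that make the receivers unimodular. Since \<open>w' - w\<close> lies in the ideal of
  the other members, the same multiples of \<open>w\<close> alone make the whole family unimodular.\<close>

lemma sr_cond_family:
  fixes a b :: "'i \<Rightarrow> 'a :: comm_ring_1"
  assumes sr: "sr_cond TYPE('a) s" and A: "finite A" "s \<le> card A"
    and one: "(\<Sum>i\<in>A. a i * b i) + w = 1"
  shows "\<exists>c e. (\<Sum>i\<in>A. (a i + c i * w) * e i) = 1"
proof -
  obtain A1 where A1: "A1 \<subseteq> A" "card A1 = s" "finite A1"
    using A obtain_subset_with_card_n by metis
  obtain f where f: "bij_betw f {0..<s} A1"
    using ex_bij_betw_nat_finite[OF A1(3)] A1(2) by auto
  define w' where "w' = (\<Sum>i\<in>A - A1. a i * b i) + w"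
  have split: "(\<Sum>i\<in>A. g i) = (\<Sum>i\<in>A1. g i) + (\<Sum>i\<in>A - A1. g i)" for g :: "'i \<Rightarrow> 'a"
    using A A1 by (simp add: sum.subset_diff)
  have re: "(\<Sum>i\<in>A1. g i) = (\<Sum>k<s. g (f k))" for g :: "'i \<Rightarrow> 'a"
    using sum.reindex_bij_betw[OF f, of g] unfolding lessThan_atLeast0 by simp
  have w'1: "(\<Sum>k<s. a (f k) * b (f k)) + w' = 1"
    using one split[of "\<lambda>i. a i * b i"] re[of "\<lambda>i. a i * b i"] by (simp add: w'_def add.assoc)
  define u where "u = vec (s + 1) (\<lambda>k. if k < s then a (f k) else w')"
  define v where "v = vec (s + 1) (\<lambda>k. if k < s then b (f k) else 1)"
  have "u \<bullet> v = 1"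
    using w'1 by (simp add: scalar_prod_def u_def v_def lessThan_atLeast0[symmetric])
  then have "u \<in> Um_row (s + 1)"
    by (auto simp: Um_row_def u_def v_def)
  then obtain c where c: "c \<in> carrier_vec s" and "vec s (\<lambda>i. u $ i + c $ i * u $ s) \<in> Um_row s"
    using sr unfolding sr_cond_def by blast
  then obtain e where e: "e \<in> carrier_vec s" "vec s (\<lambda>i. u $ i + c $ i * u $ s) \<bullet> e = 1"
    by (auto simp: Um_row_def)
  then have e1: "(\<Sum>k<s. (a (f k) + c $ k * w') * e $ k) = 1"
    by (simp add: scalar_prod_def u_def lessThan_atLeast0[symmetric])
  define fi where "fi = the_inv_into {0..<s} f"
  have fi: "fi (f k) = k" if "k < s" for k
    using that f by (auto simp: fi_def bij_betw_def intro!: the_inv_into_f_f)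
  have fA: "f k \<in> A1" if "k < s" for k
    using that f by (auto simp: bij_betw_def)
  define t where "t = (\<Sum>k<s. c $ k * e $ k)"
  \<comment> \<open>The coefficients at the members outside \<open>A1\<close> restore the part \<open>(w' - w) * t\<close>.\<close>
  define c' where "c' i = (if i \<in> A1 then c $ fi i else 0)" for i
  define e' where "e' i = (if i \<in> A1 then e $ fi i else b i * t)" for i
  have "(\<Sum>i\<in>A. (a i + c' i * w) * e' i)
      = (\<Sum>k<s. (a (f k) + c $ k * w) * e $ k) + (\<Sum>i\<in>A - A1. a i * b i * t)"
    unfolding split re by (simp add: c'_def e'_def fi fA mult.assoc)
  also have "(\<Sum>i\<in>A - A1. a i * b i * t) = (w' - w) * t"
    by (simp add: w'_def sum_distrib_right)
  also have "\<dots> = (\<Sum>k<s. c $ k * (w' - w) * e $ k)"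
    by (simp add: t_def sum_distrib_left mult_ac)
  also have "(\<Sum>k<s. (a (f k) + c $ k * w) * e $ k) + (\<Sum>k<s. c $ k * (w' - w) * e $ k)
      = (\<Sum>k<s. (a (f k) + c $ k * w') * e $ k)"
    unfolding sum.distrib[symmetric] by (rule sum.cong) (auto simp: algebra_simps)
  finally show ?thesis using e1 by metis
qed

section \<open>Clearing one diagonal entry\<close>

lemma Um_mat_mult_unit:
  fixes S :: "'a :: comm_ring_1 mat"
  assumes "S \<in> Um_mat m n" and G: "G \<in> E_group m" and E: "E \<in> E_group n"
  shows "G * S * E \<in> Um_mat m n"
proof -
  obtain B where B: "S \<in> carrier_mat m n" "B \<in> carrier_mat n m" "S * B = 1\<^sub>m m"
    using assms(1) by (auto simp: Um_mat_def)
  obtain H where H: "G \<in> carrier_mat m m" "H \<in> carrier_mat m m" "G * H = 1\<^sub>m m"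
    using E_group_unit[OF G] by auto
  obtain D where D: "E \<in> carrier_mat n n" "D \<in> carrier_mat n n" "E * D = 1\<^sub>m n"
    using E_group_unit[OF E] by auto
  have "(G * S * E) * (D * (B * H)) = G * S * (E * (D * (B * H)))"
    using B D H by (intro assoc_mult_mat[of _ m n _ n _ m]) auto
  also have "E * (D * (B * H)) = E * D * (B * H)"
    using B D H by (intro assoc_mult_mat[symmetric, of _ n n _ n _ m]) auto
  also have "\<dots> = B * H" unfolding D(3) using B H by simp
  also have "G * S * (B * H) = G * (S * (B * H))"
    using B H by (simp add: assoc_mult_mat[of _ m m _ n _ m])
  also have "S * (B * H) = S * B * H"
    using B H by (intro assoc_mult_mat[symmetric, of _ m n _ m _ m]) auto
  also have "G * (S * B * H) = 1\<^sub>m m" using B H by simp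
  finally show ?thesis
    using B D H unfolding Um_mat_def
    by (auto intro!: bexI[of _ "D * (B * H)"])
qed

text \<open>The first shear adds \<open>c i * u l\<close> times column \<open>l \<le> k\<close> to each column \<open>i > k\<close>, the second adds \<open>e i\<close>
  times column \<open>i > k\<close> to column \<open>k\<close>.\<close>

lemma two_column_shears:
  fixes S :: "'a :: comm_ring_1 mat" and u c e :: "nat \<Rightarrow> 'a"
  assumes S: "S \<in> carrier_mat m n" and k: "k < m" "k < n"
  shows "\<exists>E \<in> E_group n. (\<forall>i<m. \<forall>j<k. (S * E) $$ (i, j) = S $$ (i, j)) \<and>
    (S * E) $$ (k, k) = S $$ (k, k) +
      (\<Sum>i\<in>{k<..<n}. (S $$ (k, i) + c i * (\<Sum>l\<le>k. S $$ (k, l) * u l)) * e i)"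
proof -
  define N1 where "N1 = mat n n (\<lambda>(l, i). if l \<le> k \<and> k < i then u l * c i else 0)"
  define N2 where "N2 = mat n n (\<lambda>(i, l). if k < i \<and> l = k then e i else 0)"
  have N: "N1 \<in> carrier_mat n n" "N2 \<in> carrier_mat n n" by (auto simp: N1_def N2_def)
  have "1\<^sub>m n + N1 \<in> E_group n"
    by (rule E_group_shear[of _ _ "{..k}"]) (auto simp: N1_def split: if_splits)
  moreover have "1\<^sub>m n + N2 \<in> E_group n"
    by (rule E_group_shear[of _ _ "{k<..}"]) (auto simp: N2_def split: if_splits)
  ultimately have E: "(1\<^sub>m n + N1) * (1\<^sub>m n + N2) \<in> E_group n" by (rule E_group_mult)
  define S1 where "S1 = S * (1\<^sub>m n + N1)"
  have S1: "S1 \<in> carrier_mat m n" using S N by (simp add: S1_def)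
  have SE: "S * ((1\<^sub>m n + N1) * (1\<^sub>m n + N2)) = S1 * (1\<^sub>m n + N2)"
    using S N by (simp add: S1_def assoc_mult_mat[of _ m n _ n _ n])
  have S1_le: "S1 $$ (i, j) = S $$ (i, j)" if "i < m" "j \<le> k" for i j
    using that k index_mult_one_plus[OF S N(1), of i j] by (simp add: S1_def N1_def)
  have S1_gt: "S1 $$ (k, i) = S $$ (k, i) + c i * (\<Sum>l\<le>k. S $$ (k, l) * u l)"
    if i: "i \<in> {k<..<n}" for i
  proof -
    have "(\<Sum>l<n. S $$ (k, l) * N1 $$ (l, i)) = (\<Sum>l\<le>k. S $$ (k, l) * (u l * c i))"
      by (rule sum.mono_neutral_cong_right) (use i k in \<open>auto simp: N1_def\<close>)
    then show ?thesis
      using i k index_mult_one_plus[OF S N(1), of k i]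
      by (simp add: S1_def sum_distrib_left mult_ac)
  qed
  have "(S1 * (1\<^sub>m n + N2)) $$ (i, j) = S $$ (i, j)" if "i < m" "j < k" for i j
    using that k index_mult_one_plus[OF S1 N(2), of i j] S1_le[of i j] by (simp add: N2_def)
  moreover have "(S1 * (1\<^sub>m n + N2)) $$ (k, k) = S $$ (k, k) +
      (\<Sum>i\<in>{k<..<n}. (S $$ (k, i) + c i * (\<Sum>l\<le>k. S $$ (k, l) * u l)) * e i)"
  proof -
    have "(\<Sum>i<n. S1 $$ (k, i) * N2 $$ (i, k)) = (\<Sum>i\<in>{k<..<n}. S1 $$ (k, i) * e i)"
      by (rule sum.mono_neutral_cong_right) (use k in \<open>auto simp: N2_def\<close>)
    then show ?thesis
      using k index_mult_one_plus[OF S1 N(2), of k k] S1_le[of k k] S1_gt by simp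
  qed
  ultimately show ?thesis by (intro bexI[OF _ E]) (simp add: SE)
qed

lemma Um_mat_row:
  assumes "S \<in> Um_mat m n" "k < m"
  obtains p where "(\<Sum>j<n. S $$ (k, j) * p j) = (1 :: 'a :: comm_ring_1)"
proof -
  obtain B where B: "S \<in> carrier_mat m n" "B \<in> carrier_mat n m" "S * B = 1\<^sub>m m"
    using assms(1) by (auto simp: Um_mat_def)
  have "(\<Sum>j<n. S $$ (k, j) * B $$ (j, k)) = 1"
    using index_mult_mat_sum[OF B(1,2), of k k] B(3) assms(2) by simp
  then show thesis by (rule that)
qed

text \<open>The heart of the argument. Neither of the two rows has to become unimodular beyond
  index \<open>k\<close> by itself, only both together, and this doubles the number of entries available to
  the stable range condition.\<close>

lemma diagonal_sum_one:
  fixes S T :: "'a :: comm_ring_1 mat"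
  assumes sr: "sr_cond TYPE('a) s" and k: "k < m" "k < n" and s: "s \<le> 2 * (n - 1 - k)"
    and S: "S \<in> Um_mat m n" and T: "T \<in> Um_mat m n"
  shows "\<exists>E1 \<in> E_group n. \<exists>E2 \<in> E_group n.
    (\<forall>i<m. \<forall>j<k. (S * E1) $$ (i, j) = S $$ (i, j) \<and> (T * E2) $$ (i, j) = T $$ (i, j)) \<and>
    (S * E1) $$ (k, k) + (T * E2) $$ (k, k) = 1"
proof -
  define a where "a j = S $$ (k, j)" for j
  define b where "b j = T $$ (k, j)" for j
  let ?H = "{k<..<n}"
  obtain p where "(\<Sum>j<n. a j * p j) = 1" unfolding a_def using Um_mat_row[OF S k(1)] by auto
  moreover obtain q where "(\<Sum>j<n. b j * q j) = 1" unfolding b_def using Um_mat_row[OF T k(1)] by auto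
  moreover have "(\<Sum>j<n. g j) = (\<Sum>j\<le>k. g j) + (\<Sum>j\<in>?H. g j)" for g :: "nat \<Rightarrow> 'a"
  proof -
    have "{..<n} = {..k} \<union> ?H" "{..k} \<inter> ?H = {}" using k by auto
    then show ?thesis by (simp add: sum.union_disjoint)
  qed
  ultimately have ap: "(\<Sum>j\<le>k. a j * p j) + (\<Sum>j\<in>?H. a j * p j) = 1"
    and bq: "(\<Sum>j\<le>k. b j * q j) + (\<Sum>j\<in>?H. b j * q j) = 1" by simp_all
  define P where "P = (\<Sum>j\<le>k. a j * p j)"
  define Q where "Q = (\<Sum>j\<le>k. b j * q j)"
  define ab where "ab = case_sum a b"
  \<comment> \<open>From \<open>1 = A + P\<close> and \<open>1 = B + Q\<close> follows \<open>1 = A + P (B + Q) = A + P B + P Q\<close>.\<close>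
  have "(\<Sum>x\<in>?H <+> ?H. ab x * case_sum p (\<lambda>j. P * q j) x) + P * Q
      = (\<Sum>j\<in>?H. a j * p j) + P * ((\<Sum>j\<in>?H. b j * q j) + Q)"
    by (simp add: sum.Plus ab_def sum_distrib_left algebra_simps)
  also have "\<dots> = 1" using ap bq by (simp add: P_def Q_def add.commute)
  finally have one: "(\<Sum>x\<in>?H <+> ?H. ab x * case_sum p (\<lambda>j. P * q j) x) + P * Q = 1" .
  have "s \<le> card (?H <+> ?H)" using s by (simp add: card_Plus)
  then obtain c e where ce: "(\<Sum>x\<in>?H <+> ?H. (ab x + c x * (P * Q)) * e x) = 1"
    using sr_cond_family[OF sr _ _ one] by auto
  define t where "t = 1 - a k - b k"
  \<comment> \<open>Multiples of \<open>P Q\<close> can be produced from the columns up to \<open>k\<close> of \<open>S\<close> alone, and of \<open>T\<close> alone.\<close>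
  have PQ: "P * Q = (\<Sum>j\<le>k. a j * (p j * Q))" "P * Q = (\<Sum>j\<le>k. b j * (q j * P))"
    unfolding sum_distrib_right[symmetric] mult.assoc[symmetric]
    by (simp_all add: P_def Q_def mult.commute)
  have Sm: "S \<in> carrier_mat m n" and Tm: "T \<in> carrier_mat m n"
    using S T by (auto simp: Um_mat_def)
  obtain E1 where E1: "E1 \<in> E_group n" "\<forall>i<m. \<forall>j<k. (S * E1) $$ (i, j) = S $$ (i, j)"
    "(S * E1) $$ (k, k) = a k + (\<Sum>i\<in>?H. (a i + c (Inl i) * (P * Q)) * (e (Inl i) * t))"
    using two_column_shears[OF Sm k, of "\<lambda>i. c (Inl i)" "\<lambda>j. p j * Q" "\<lambda>i. e (Inl i) * t"]
    unfolding a_def[symmetric] PQ(1)[symmetric] by blast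
  obtain E2 where E2: "E2 \<in> E_group n" "\<forall>i<m. \<forall>j<k. (T * E2) $$ (i, j) = T $$ (i, j)"
    "(T * E2) $$ (k, k) = b k + (\<Sum>i\<in>?H. (b i + c (Inr i) * (P * Q)) * (e (Inr i) * t))"
    using two_column_shears[OF Tm k, of "\<lambda>i. c (Inr i)" "\<lambda>j. q j * P" "\<lambda>i. e (Inr i) * t"]
    unfolding b_def[symmetric] PQ(2)[symmetric] by blast
  have "(S * E1) $$ (k, k) + (T * E2) $$ (k, k)
      = a k + b k + (\<Sum>x\<in>?H <+> ?H. (ab x + c x * (P * Q)) * e x) * t"
    unfolding E1(3) E2(3) by (simp add: sum.Plus ab_def sum_distrib_right distrib_right mult.assoc)
  also have "\<dots> = 1" unfolding ce by (simp add: t_def)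
  finally show ?thesis using E1(1,2) E2(1,2) by blast
qed

section \<open>Making the square blocks sum to the identity\<close>

definition stabilize :: "nat \<Rightarrow> 'a :: comm_ring_1 mat \<Rightarrow> 'a mat" where
  "stabilize r G = four_block_mat G (0\<^sub>m (dim_row G) r) (0\<^sub>m r (dim_col G)) (1\<^sub>m r)"

lemma stabilize_mult:
  "G \<in> carrier_mat m m \<Longrightarrow> H \<in> carrier_mat m m \<Longrightarrow> stabilize r (G * H) = stabilize r G * stabilize r H"
  unfolding stabilize_def by (auto simp: mult_four_block_mat[of _ m m _ r _ r _ _ m _ r])

text \<open>\<open>C\<close> subtracts \<open>v i\<close> times row \<open>k\<close> from each other row \<open>i\<close>. It sends \<open>v\<close> to \<open>e\<^sub>k\<close> and differs
  from the identity only in column \<open>k\<close>, so it fixes every other basis vector. The same shear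
  in size \<open>m + r\<close> is \<open>stabilize r C\<close>.\<close>

lemma clear_column:
  fixes v :: "nat \<Rightarrow> 'a :: comm_ring_1"
  assumes k: "k < m" and v: "v k = 1"
  shows "\<exists>C \<in> E_group m. stabilize r C \<in> E_group (m + r) \<and>
    (\<forall>i<m. (\<Sum>l<m. C $$ (i, l) * v l) = (if i = k then 1 else 0)) \<and>
    (\<forall>j<m. j \<noteq> k \<longrightarrow> (\<forall>i<m. C $$ (i, j) = (if i = j then 1 else 0)))"
proof -
  define N where "N n = mat n n (\<lambda>(i, l). if l = k \<and> i \<noteq> k \<and> i < m then - v i else 0)" for n
  have N: "N n \<in> carrier_mat n n" for n by (simp add: N_def)
  have E: "1\<^sub>m n + N n \<in> E_group n" for n
    by (rule E_group_shear[of _ _ "- {k}"]) (auto simp: N_def split: if_splits)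
  have "stabilize r (1\<^sub>m m + N m) = 1\<^sub>m (m + r) + N (m + r)"
    using k by (intro eq_matI) (auto simp: stabilize_def N_def)
  then have "stabilize r (1\<^sub>m m + N m) \<in> E_group (m + r)" by (simp add: E)
  moreover have "(\<Sum>l<m. (1\<^sub>m m + N m) $$ (i, l) * v l) = (if i = k then 1 else 0)" if i: "i < m" for i
  proof -
    have "(\<Sum>l<m. (1\<^sub>m m + N m) $$ (i, l) * v l)
        = (\<Sum>l<m. (if l = i then v i else 0) + (if l = k then (if i = k then 0 else - v i) else 0))"
      by (rule sum.cong) (use i k v in \<open>auto simp: N_def\<close>)
    also have "\<dots> = (if i = k then 1 else 0)"
      using i k v by (simp add: sum.distrib)
    finally show ?thesis .
  qed
  moreover have "\<forall>j<m. j \<noteq> k \<longrightarrow> (\<forall>i<m. (1\<^sub>m m + N m) $$ (i, j) = (if i = j then 1 else 0))"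
    by (auto simp: N_def)
  ultimately show ?thesis using E[of m] by blast
qed

text \<open>The left factor \<open>G\<close> is the same for \<open>S\<close> and \<open>T\<close>. This is what makes it removable by
  conjugation, since conjugation fixes the identity that the two square blocks sum to. The
  clause on \<open>stabilize r G\<close> is carried along because the conjugation has to be completed by an elementary
  right factor.\<close>

lemma leading_columns_sum:
  fixes S T :: "'a :: comm_ring_1 mat"
  assumes sr: "sr_cond TYPE('a) s" and s: "s \<le> 2 * r" and r: "0 < r"
    and S: "S \<in> Um_mat m (m + r)" and T: "T \<in> Um_mat m (m + r)"
    and km: "k \<le> m"
  shows "\<exists>G \<in> E_group m. \<exists>E1 \<in> E_group (m + r). \<exists>E2 \<in> E_group (m + r).
    stabilize r G \<in> E_group (m + r) \<and>
    (\<forall>i<m. \<forall>j<k. (G * S * E1) $$ (i, j) + (G * T * E2) $$ (i, j) = (if i = j then 1 else 0))"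
  using km
proof (induction k)
  case 0
  have "stabilize r (1\<^sub>m m :: 'a mat) = 1\<^sub>m (m + r)"
    by (intro eq_matI) (auto simp: stabilize_def)
  then show ?case using E_group_one by (intro bexI[of _ "1\<^sub>m _"]) auto
next
  case (Suc k)
  let ?n = "m + r"
  obtain G E1 E2 where GE: "G \<in> E_group m" "E1 \<in> E_group ?n" "E2 \<in> E_group ?n"
    "stabilize r G \<in> E_group ?n"
    and IH: "\<And>i j. i < m \<Longrightarrow> j < k \<Longrightarrow>
      (G * S * E1) $$ (i, j) + (G * T * E2) $$ (i, j) = (if i = j then 1 else 0)"
    using Suc by (auto simp: Suc_le_eq)
  have k: "k < m" "k < ?n" and sk: "s \<le> 2 * (?n - 1 - k)" using Suc.prems s r by auto
  define S1 where "S1 = G * S * E1"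
  define T1 where "T1 = G * T * E2"
  have S1: "S1 \<in> Um_mat m ?n" and T1: "T1 \<in> Um_mat m ?n"
    using Um_mat_mult_unit GE S T by (auto simp: S1_def T1_def)
  obtain F1 F2 where F: "F1 \<in> E_group ?n" "F2 \<in> E_group ?n"
    and old: "\<And>i j. i < m \<Longrightarrow> j < k \<Longrightarrow> (S1 * F1) $$ (i, j) = S1 $$ (i, j)"
      "\<And>i j. i < m \<Longrightarrow> j < k \<Longrightarrow> (T1 * F2) $$ (i, j) = T1 $$ (i, j)"
    and new: "(S1 * F1) $$ (k, k) + (T1 * F2) $$ (k, k) = 1"
    using diagonal_sum_one[OF sr k sk S1 T1] by blast
  define v where "v i j = (S1 * F1) $$ (i, j) + (T1 * F2) $$ (i, j)" for i j
  obtain C where C: "C \<in> E_group m" "stabilize r C \<in> E_group ?n"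
    and Cv: "\<And>i. i < m \<Longrightarrow> (\<Sum>l<m. C $$ (i, l) * v l k) = (if i = k then 1 else 0)"
    and Cj: "\<And>i j. i < m \<Longrightarrow> j < m \<Longrightarrow> j \<noteq> k \<Longrightarrow> C $$ (i, j) = (if i = j then 1 else 0)"
    using clear_column[of k m "\<lambda>l. v l k" r] k new by (auto simp: v_def)
  have car: "C \<in> carrier_mat m m" "G \<in> carrier_mat m m" "E1 \<in> carrier_mat ?n ?n"
    "E2 \<in> carrier_mat ?n ?n" "F1 \<in> carrier_mat ?n ?n" "F2 \<in> carrier_mat ?n ?n"
    "S \<in> carrier_mat m ?n" "T \<in> carrier_mat m ?n"
    using C GE F S T by (auto simp: E_group_unit Um_mat_def)
  have eqS: "C * G * S * (E1 * F1) = C * (S1 * F1)"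
    and eqT: "C * G * T * (E2 * F2) = C * (T1 * F2)"
    using car by (simp_all add: S1_def T1_def assoc_mult_mat[of _ m m _ m _ ?n]
        assoc_mult_mat[of _ m m _ ?n _ ?n] assoc_mult_mat[of _ m ?n _ ?n _ ?n])
  have "(C * G * S * (E1 * F1)) $$ (i, j) + (C * G * T * (E2 * F2)) $$ (i, j) = (if i = j then 1 else 0)"
    if i: "i < m" and j: "j < Suc k" for i j
  proof -
    have cS: "S1 * F1 \<in> carrier_mat m ?n" and cT: "T1 * F2 \<in> carrier_mat m ?n"
      using S1 T1 car(5,6) by (auto simp: Um_mat_def intro: mult_carrier_mat)
    have jn: "j < ?n" using j k by simp
    have "(C * (S1 * F1)) $$ (i, j) + (C * (T1 * F2)) $$ (i, j) = (\<Sum>l<m. C $$ (i, l) * v l j)"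
      unfolding index_mult_mat_sum[OF car(1) cS i jn] index_mult_mat_sum[OF car(1) cT i jn]
      by (simp add: v_def sum.distrib distrib_left)
    also have "\<dots> = (if i = j then 1 else 0)"
    proof (cases "j = k")
      case True
      then show ?thesis using Cv[OF i] by simp
    next
      case False
      then have jk: "j < k" using j by simp
      then have "(\<Sum>l<m. C $$ (i, l) * v l j) = (\<Sum>l<m. if l = j then C $$ (i, j) else 0)"
        using IH by (intro sum.cong) (auto simp: v_def old S1_def[symmetric] T1_def[symmetric])
      then show ?thesis using jk k i Cj[of i j] by simp
    qed
    finally show ?thesis unfolding eqS eqT .
  qed
  moreover have "C * G \<in> E_group m" "E1 * F1 \<in> E_group ?n" "E2 * F2 \<in> E_group ?n"
    using C GE F by (auto intro: E_group_mult)
  moreover have "stabilize r (C * G) \<in> E_group ?n"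
    using C GE car by (simp add: stabilize_mult E_group_mult)
  ultimately show ?case by blast
qed

section \<open>Block form\<close>

lemma append_cols_split:
  assumes "M \<in> carrier_mat m (m + r)"
  obtains X A where "X \<in> carrier_mat m m" "A \<in> carrier_mat m r" "M = append_cols X A"
    "\<And>i j. i < m \<Longrightarrow> j < m \<Longrightarrow> X $$ (i, j) = M $$ (i, j)"
proof -
  define X where "X = mat m m (\<lambda>p. M $$ p)"
  define A where "A = mat m r (\<lambda>(i, j). M $$ (i, m + j))"
  show thesis
    by (rule that[of X A])
      (use assms in \<open>auto simp: X_def A_def append_cols_def intro!: eq_matI\<close>)
qed

lemma mult_append_cols:
  fixes H :: "'a :: comm_ring_1 mat"
  assumes "H \<in> carrier_mat m m" "X \<in> carrier_mat m m" "A \<in> carrier_mat m r"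
  shows "H * append_cols X A = append_cols (H * X) (H * A)"
proof -
  have "H = four_block_mat H (0\<^sub>m m 0) (0\<^sub>m 0 m) (0\<^sub>m 0 0)"
    using assms by (intro eq_matI) auto
  then have "H * append_cols X A = four_block_mat H (0\<^sub>m m 0) (0\<^sub>m 0 m) (0\<^sub>m 0 0) *
      four_block_mat X A (0\<^sub>m 0 m) (0\<^sub>m 0 r)"
    using assms by (simp add: append_cols_def)
  also have "\<dots> = append_cols (H * X) (H * A)"
    using assms by (subst mult_four_block_mat[of _ m m _ 0 _ 0 _ _ m _ r]) (auto simp: append_cols_def)
  finally show ?thesis .
qed

lemma append_cols_mult_block:
  fixes X :: "'a :: comm_ring_1 mat"
  assumes "X \<in> carrier_mat m m" "A \<in> carrier_mat m r" "P \<in> carrier_mat m m" "Q \<in> carrier_mat m r"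
  shows "append_cols X A * four_block_mat P Q (0\<^sub>m r m) (1\<^sub>m r) = append_cols (X * P) (X * Q + A)"
  unfolding append_cols_def using assms
  by (subst mult_four_block_mat[of _ m m _ r _ 0 _ _ m _ r]) auto

lemma E_group_block:
  fixes U :: "'a :: comm_ring_1 mat"
  assumes "U \<in> carrier_mat m r"
  shows "four_block_mat (1\<^sub>m m) U (0\<^sub>m r m) (1\<^sub>m r) \<in> E_group (m + r)"
proof -
  let ?N = "four_block_mat (0\<^sub>m m m) U (0\<^sub>m r m) (0\<^sub>m r r)"
  have "four_block_mat (1\<^sub>m m) U (0\<^sub>m r m) (1\<^sub>m r) = 1\<^sub>m (m + r) + ?N"
    using assms by (intro eq_matI) auto
  moreover have "1\<^sub>m (m + r) + ?N \<in> E_group (m + r)"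
    by (rule E_group_shear[of _ _ "{..<m}"]) (use assms in \<open>auto split: if_splits\<close>)
  ultimately show ?thesis by simp
qed

text \<open>Since \<open>S E = H (G S E)\<close>, multiplying by \<open>H\<close> undoes the row operations, and the right factor
  \<open>stabilize r G\<close> acts on the square block only, turning it into a conjugate of \<open>X\<close>.\<close>

lemma append_cols_conj:
  fixes S G :: "'a :: comm_ring_1 mat"
  assumes S: "S \<in> carrier_mat m (m + r)" and E: "E \<in> carrier_mat (m + r) (m + r)"
    and G: "G \<in> carrier_mat m m" and H: "H \<in> carrier_mat m m" "H * G = 1\<^sub>m m"
    and X: "X \<in> carrier_mat m m" "A \<in> carrier_mat m r" "G * S * E = append_cols X A"
  shows "S * (E * stabilize r G) = append_cols (H * X * G) (H * A)"
proof -
  let ?n = "m + r"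
  have G': "stabilize r G \<in> carrier_mat ?n ?n" using G by (simp add: stabilize_def)
  have "S * (E * stabilize r G) = S * E * stabilize r G"
    using S E G' by (simp add: assoc_mult_mat[of _ m ?n _ ?n _ ?n])
  also have "S * E = H * G * (S * E)" using H S E by simp
  also have "\<dots> = H * (G * S * E)"
    using G H(1) S E by (simp add: assoc_mult_mat[of _ m m _ m _ ?n] assoc_mult_mat[of _ m m _ ?n _ ?n])
  also have "\<dots> = append_cols (H * X) (H * A)"
    using X H by (simp add: mult_append_cols)
  also have "\<dots> * stabilize r G = append_cols (H * X * G) (H * X * 0\<^sub>m m r + H * A)"
    unfolding stabilize_def using G H X by (simp add: append_cols_mult_block)
  finally show ?thesis using G H X by simp
qed

theorem lemma1p1:
  fixes S T :: "'a :: comm_ring_1 mat" and m n d :: nat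
  assumes "sdim TYPE('a) = enat d"
    and "m \<ge> 2" and "n > m" and "d \<le> 2 * (n - m) - 1"
    and "S \<in> Um_mat m n" and "T \<in> Um_mat m n"
  shows "\<exists>\<epsilon>1 \<in> E_group n. \<exists>\<epsilon>2 \<in> E_group n.
           \<exists>X \<in> carrier_mat m m. \<exists>\<alpha> \<in> carrier_mat m (n - m).
             S * \<epsilon>1 = append_cols X \<alpha> \<and> T * \<epsilon>2 = append_cols (1\<^sub>m m - X) \<alpha>"
proof -
  define r where "r = n - m"
  have n: "n = m + r" and r: "0 < r" and s: "d + 1 \<le> 2 * r"
    using assms(3,4) by (auto simp: r_def)
  note Um = assms(5,6)[unfolded n]
  obtain G E1 E2 where G: "G \<in> E_group m" and E: "E1 \<in> E_group n" "E2 \<in> E_group n"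
    and stab: "stabilize r G \<in> E_group n"
    and sum: "\<And>i j. i < m \<Longrightarrow> j < m \<Longrightarrow>
      (G * S * E1) $$ (i, j) + (G * T * E2) $$ (i, j) = (if i = j then 1 else 0)"
    using leading_columns_sum[OF sr_cond_of_sdim[OF assms(1)] s r Um, of m] n by auto
  have S: "S \<in> carrier_mat m (m + r)" and T: "T \<in> carrier_mat m (m + r)"
    using Um by (auto simp: Um_mat_def)
  have Ec: "E1 \<in> carrier_mat (m + r) (m + r)" "E2 \<in> carrier_mat (m + r) (m + r)"
    using E E_group_unit(1) n by auto
  obtain H where Gc: "G \<in> carrier_mat m m" and H: "H \<in> carrier_mat m m" "H * G = 1\<^sub>m m"
    using E_group_unit[OF G] by auto
  have "G * S * E1 \<in> carrier_mat m (m + r)" using Gc S Ec by simp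
  then obtain X A where X: "X \<in> carrier_mat m m" "A \<in> carrier_mat m r" "G * S * E1 = append_cols X A"
    and Xe: "\<And>i j. i < m \<Longrightarrow> j < m \<Longrightarrow> X $$ (i, j) = (G * S * E1) $$ (i, j)"
    using append_cols_split by blast
  have "G * T * E2 \<in> carrier_mat m (m + r)" using Gc T Ec by simp
  then obtain Y B where Y: "Y \<in> carrier_mat m m" "B \<in> carrier_mat m r" "G * T * E2 = append_cols Y B"
    and Ye: "\<And>i j. i < m \<Longrightarrow> j < m \<Longrightarrow> Y $$ (i, j) = (G * T * E2) $$ (i, j)"
    using append_cols_split by blast
  have XY: "X + Y = 1\<^sub>m m"
    using X(1) Y(1) Xe Ye sum by (intro eq_matI) auto
  define X' where "X' = H * X * G"
  define Y' where "Y' = H * Y * G"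
  define A' where "A' = H * A"
  define B' where "B' = H * B"
  have c: "X' \<in> carrier_mat m m" "Y' \<in> carrier_mat m m" "A' \<in> carrier_mat m r" "B' \<in> carrier_mat m r"
    using Gc H X Y by (simp_all add: X'_def Y'_def A'_def B'_def)
  have "X' + Y' = H * (X + Y) * G"
    using Gc H(1) X Y by (simp add: X'_def Y'_def mult_add_distrib_mat[of _ m m _ m]
        add_mult_distrib_mat[of _ m m _ _ m])
  also have "\<dots> = 1\<^sub>m m" using Gc H by (simp add: XY)
  finally have XY': "X' + Y' = 1\<^sub>m m" .
  have Y'_eq: "Y' = 1\<^sub>m m - X'"
  proof -
    have "Y' = X' + Y' - X'" using c by (intro eq_matI) auto
    then show ?thesis by (simp add: XY')
  qed
  \<comment> \<open>With \<open>X' + Y' = 1\<close>, both \<open>A' + X' (B' - A')\<close> and \<open>B' + Y' (A' - B')\<close> equal \<open>Y' A' + X' B'\<close>.\<close>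
  define J1 where "J1 = four_block_mat (1\<^sub>m m) (B' - A') (0\<^sub>m r m) (1\<^sub>m r)"
  define J2 where "J2 = four_block_mat (1\<^sub>m m) (A' - B') (0\<^sub>m r m) (1\<^sub>m r)"
  have BA: "B' - A' \<in> carrier_mat m r" "A' - B' \<in> carrier_mat m r"
    using c by (auto intro: minus_carrier_mat)
  have J: "J1 \<in> E_group n" "J2 \<in> E_group n"
    unfolding J1_def J2_def n by (rule E_group_block, rule BA)+
  define F1 where "F1 = E1 * stabilize r G"
  define F2 where "F2 = E2 * stabilize r G"
  have F: "F1 \<in> E_group n" "F2 \<in> E_group n"
    using E stab by (simp_all add: F1_def F2_def E_group_mult)
  have assoc: "M * (F * J) = M * F * J" if "M \<in> carrier_mat m (m + r)" "F \<in> E_group n" "J \<in> E_group n"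
    for M F J :: "'a mat"
    using that E_group_unit(1) unfolding n
    by (intro assoc_mult_mat[symmetric, of _ m "m + r" _ "m + r" _ "m + r"]) auto
  have "S * (F1 * J1) = append_cols X' A' * J1"
    using append_cols_conj[OF S Ec(1) Gc H X] assoc[OF S F(1) J(1)] by (simp add: F1_def X'_def A'_def)
  then have SE: "S * (F1 * J1) = append_cols X' (X' * (B' - A') + A')"
    unfolding J1_def using c append_cols_mult_block[OF c(1,3) one_carrier_mat BA(1)] by simp
  have "T * (F2 * J2) = append_cols Y' B' * J2"
    using append_cols_conj[OF T Ec(2) Gc H Y] assoc[OF T F(2) J(2)] by (simp add: F2_def Y'_def B'_def)
  then have "T * (F2 * J2) = append_cols Y' (Y' * (A' - B') + B')"
    unfolding J2_def using c append_cols_mult_block[OF c(2,4) one_carrier_mat BA(2)] by simp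
  moreover have "Y' * (A' - B') + B' = X' * (B' - A') + A'"
  proof -
    have "Y' * (A' - B') = (A' - B') - X' * (A' - B')"
      unfolding Y'_eq minus_mult_distrib_mat[OF one_carrier_mat c(1) BA(2)]
      by (simp only: left_mult_one_mat[OF BA(2)])
    moreover have "X' * (A' - B') = X' * A' - X' * B'" "X' * (B' - A') = X' * B' - X' * A'"
      using c by (simp_all add: mult_minus_distrib_mat[of _ m m _ r])
    moreover have "X' * A' \<in> carrier_mat m r" "X' * B' \<in> carrier_mat m r" using c by simp_all
    ultimately show ?thesis using c by (intro eq_matI) auto
  qed
  ultimately have TE: "T * (F2 * J2) = append_cols (1\<^sub>m m - X') (X' * (B' - A') + A')"
    by (simp add: Y'_eq)
  have "X' * (B' - A') + A' \<in> carrier_mat m (n - m)" using c by (simp add: n)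
  then show ?thesis
    using SE TE c(1) E_group_mult[OF F(1) J(1)] E_group_mult[OF F(2) J(2)] by blast
qed

end
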